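(* Let $(Y_i(1),Y_i(0),R_i(1),R_i(0),X_i)$ be a random vector with $Y_i(d)$ real-valued, $R_i(d)\in\{0,1\}$, $E[|Y_i(d)|]<\infty$ and $E[R_i(d)]>0$ for $d\in\{0,1\}$. Let $S_i=S(X_i)$, where $S$ is a function from the support of $X_i$ into a finite set $\mathcal S$, and let $\nu\in(0,1)$. Write \[\Lambda=E\left[\frac{E[R_i(1)\mid S_i]E[R_i(0)\mid S_i]}{\nu E[R_i(1)\mid S_i]+(1-\nu)E[R_i(0)\mid S_i]}\right].\] Define $\theta=E[Y_i(1)-Y_i(0)]$, $\tau(s)=E[Y_i(1)-Y_i(0)\mid S_i=s]$, $\theta^{\rm obs}=E[Y_i(1)\mid R_i(1)=1]-E[Y_i(0)\mid R_i(0)=1]$, \[\theta^{\rm sfe}=\Lambda^{-1}E\left[\frac{E[R_i(1)Y_i(1)\mid S_i]E[R_i(0)\mid S_i]-E[R_i(0)Y_i(0)\mid S_i]E[R_i(1)\mid S_i]}{\nu E[R_i(1)\mid S_i]+(1-\nu)E[R_i(0)\mid S_i]}\right],\] \[\lambda(s)=\Lambda^{-1}\,\frac{E[R_i(1)\mid S_i=s]E[R_i(0)\mid S_i=s]}{\nu E[R_i(1)\mid S_i=s]+(1-\nu)E[R_i(0)\mid S_i=s]}.\] Then: (a) If $(Y_i(1),Y_i(0))\perp\!\!\!\perp(R_i(1),R_i(0))$, then $\theta^{\rm obs}=\theta$. (b) If $(Y_i(1),Y_i(0))\perp\!\!\!\perp(R_i(1),R_i(0))\mid S_i$, then $\theta^{\rm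 sfe}=E[\tau(S_i)\lambda(S_i)]$. (c) If $S_i\perp\!\!\!\perp(R_i(1),R_i(0))$, then $\theta^{\rm sfe}=\theta^{\rm obs}$. (d) If $S_i\perp\!\!\!\perp(R_i(1),R_i(0))$ and either $(Y_i(1),Y_i(0))\perp\!\!\!\perp(R_i(1),R_i(0))$ or $(Y_i(1),Y_i(0))\perp\!\!\!\perp(R_i(1),R_i(0))\mid S_i$, then $\theta^{\rm sfe}=\theta$.
   Context: $Y_i(d)$ is the potential outcome and $R_i(d)$ the potential response indicator ($1$ = not attrited) of unit $i$ under treatment $d\in\{0,1\}$; $X_i$ are baseline covariates and $S_i$ is the stratum label; $\theta$ is the average treatment effect. $\perp\!\!\!\perp$ denotes (conditional) independence. $\theta^{\rm obs}$ and $\theta^{\rm sfe}$ are the probability limits, in a stratified experiment with target treated proportion $\nu$ in each stratum, of the coefficient on treatment in the ordinary least squares regression of outcomes on treatment among non-attritors without, respectively with, strata fixed effects. *)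

theory Defs
  imports "HOL-Probability.Probability"
begin

text \<open>
  Throughout, \<open>M\<close> is the underlying probability space, \<open>Y d\<close> and \<open>R d\<close> (for \<open>d = 0, 1\<close>) are the
  potential outcome and the potential response indicator under treatment \<open>d\<close>, and \<open>T\<close> is the
  stratum label as a random variable on \<open>M\<close> (that is, \<open>S \<circ> X\<close>).

  Division by zero yields zero.  Hence a stratum in which both conditional response
  probabilities vanish (so that the weight would be \<open>0 / 0\<close>) contributes nothing,
  and the quantities divided by \<open>mean_weight\<close> are zero when \<open>mean_weight\<close> is zero.
\<close>

text \<open>
  \<open>E[f | T]\<close>, as a random variable.  For \<open>T\<close> with values in a finite set \<open>A\<close>, measurability into
  \<open>count_space A\<close> and into \<open>count_space UNIV\<close> coincide, and so do the generated sigma-algebras.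
\<close>
definition cond_exp_rv :: "'a measure \<Rightarrow> ('a \<Rightarrow> 's) \<Rightarrow> ('a \<Rightarrow> real) \<Rightarrow> 'a \<Rightarrow> real" where
  "cond_exp_rv M T f = real_cond_exp M (vimage_algebra (space M) T (count_space UNIV)) f"

text \<open>
  \<open>E[f | A]\<close> for an event \<open>A\<close>: \<open>uniform_measure M A\<close> is the conditional probability measure
  \<open>B \<mapsto> P(A \<inter> B) / P(A)\<close>.
\<close>
definition cond_exp_event :: "'a measure \<Rightarrow> 'a set \<Rightarrow> ('a \<Rightarrow> real) \<Rightarrow> real" where
  "cond_exp_event M A f = (\<integral>\<omega>. f \<omega> \<partial>uniform_measure M A)"

definition cond_exp_at :: "'a measure \<Rightarrow> ('a \<Rightarrow> 's) \<Rightarrow> 's \<Rightarrow> ('a \<Rightarrow> real) \<Rightarrow> real" where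
  "cond_exp_at M T s f = cond_exp_event M {\<omega> \<in> space M. T \<omega> = s} f"

text \<open>
  Independence of two random variables whose values may lie in different types; the library's
  \<open>indep_var\<close> requires a common type, and this is its characterization \<open>indep_var_eq\<close>
  read for two types.
\<close>
definition indep_rv ::
  "'a measure \<Rightarrow> 'b measure \<Rightarrow> ('a \<Rightarrow> 'b) \<Rightarrow> 'c measure \<Rightarrow> ('a \<Rightarrow> 'c) \<Rightarrow> bool" where
  "indep_rv M N1 Z1 N2 Z2 \<longleftrightarrow>
     Z1 \<in> measurable M N1 \<and> Z2 \<in> measurable M N2 \<and>
     prob_space.indep_set M
       (sigma_sets (space M) {Z1 -` A \<inter> space M | A. A \<in> sets N1})
       (sigma_sets (space M) {Z2 -` A \<inter> space M | A. A \<in> sets N2})"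

text \<open>
  Conditional independence of \<open>Z1\<close> (values in \<open>N1\<close>) and \<open>Z2\<close> (values in \<open>N2\<close>) given \<open>T\<close>.
\<close>
definition cond_indep_var ::
  "'a measure \<Rightarrow> ('a \<Rightarrow> 's) \<Rightarrow> 'b measure \<Rightarrow> ('a \<Rightarrow> 'b) \<Rightarrow> 'c measure \<Rightarrow> ('a \<Rightarrow> 'c) \<Rightarrow> bool" where
  "cond_indep_var M T N1 Z1 N2 Z2 \<longleftrightarrow>
     Z1 \<in> measurable M N1 \<and> Z2 \<in> measurable M N2 \<and>
     (\<forall>A\<in>sets N1. \<forall>B\<in>sets N2. AE \<omega> in M.
        cond_exp_rv M T (indicator {\<omega> \<in> space M. Z1 \<omega> \<in> A \<and> Z2 \<omega> \<in> B}) \<omega> =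
        cond_exp_rv M T (indicator {\<omega> \<in> space M. Z1 \<omega> \<in> A}) \<omega> *
        cond_exp_rv M T (indicator {\<omega> \<in> space M. Z2 \<omega> \<in> B}) \<omega>)"

definition ate :: "'a measure \<Rightarrow> (nat \<Rightarrow> 'a \<Rightarrow> real) \<Rightarrow> real" where
  "ate M Y = (\<integral>\<omega>. Y 1 \<omega> - Y 0 \<omega> \<partial>M)"

definition stratum_ate :: "'a measure \<Rightarrow> ('a \<Rightarrow> 's) \<Rightarrow> (nat \<Rightarrow> 'a \<Rightarrow> real) \<Rightarrow> 's \<Rightarrow> real" where
  "stratum_ate M T Y s = cond_exp_at M T s (\<lambda>\<omega>. Y 1 \<omega> - Y 0 \<omega>)"

definition theta_obs ::
  "'a measure \<Rightarrow> (nat \<Rightarrow> 'a \<Rightarrow> real) \<Rightarrow> (nat \<Rightarrow> 'a \<Rightarrow> real) \<Rightarrow> real" where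
  "theta_obs M Y R =
     cond_exp_event M {\<omega> \<in> space M. R 1 \<omega> = 1} (Y 1) -
     cond_exp_event M {\<omega> \<in> space M. R 0 \<omega> = 1} (Y 0)"

text \<open>The normalizing constant \<open>\<Lambda>\<close>.\<close>
definition mean_weight ::
  "'a measure \<Rightarrow> real \<Rightarrow> ('a \<Rightarrow> 's) \<Rightarrow> (nat \<Rightarrow> 'a \<Rightarrow> real) \<Rightarrow> real" where
  "mean_weight M \<nu> T R =
     (\<integral>\<omega>. (cond_exp_rv M T (R 1) \<omega> * cond_exp_rv M T (R 0) \<omega>) /
          (\<nu> * cond_exp_rv M T (R 1) \<omega> + (1 - \<nu>) * cond_exp_rv M T (R 0) \<omega>) \<partial>M)"

definition theta_sfe ::
  "'a measure \<Rightarrow> real \<Rightarrow> ('a \<Rightarrow> 's) \<Rightarrow> (nat \<Rightarrow> 'a \<Rightarrow> real) \<Rightarrow> (nat \<Rightarrow> 'a \<Rightarrow> real) \<Rightarrow> real" where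
  "theta_sfe M \<nu> T Y R =
     inverse (mean_weight M \<nu> T R) *
     (\<integral>\<omega>. (cond_exp_rv M T (\<lambda>\<omega>. R 1 \<omega> * Y 1 \<omega>) \<omega> * cond_exp_rv M T (R 0) \<omega> -
           cond_exp_rv M T (\<lambda>\<omega>. R 0 \<omega> * Y 0 \<omega>) \<omega> * cond_exp_rv M T (R 1) \<omega>) /
          (\<nu> * cond_exp_rv M T (R 1) \<omega> + (1 - \<nu>) * cond_exp_rv M T (R 0) \<omega>) \<partial>M)"

text \<open>The weight \<open>\<lambda>(s)\<close>.\<close>
definition stratum_weight ::
  "'a measure \<Rightarrow> real \<Rightarrow> ('a \<Rightarrow> 's) \<Rightarrow> (nat \<Rightarrow> 'a \<Rightarrow> real) \<Rightarrow> 's \<Rightarrow> real" where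
  "stratum_weight M \<nu> T R s =
     inverse (mean_weight M \<nu> T R) *
     ((cond_exp_at M T s (R 1) * cond_exp_at M T s (R 0)) /
      (\<nu> * cond_exp_at M T s (R 1) + (1 - \<nu>) * cond_exp_at M T s (R 0)))"

end

theory Submission
  imports Defs
begin

text \<open>
  Since the strata are finite in number, \<open>E[f | S]\<close> agrees almost surely with the elementary
  conditional mean over the stratum, and conditional independence given \<open>S\<close> is ordinary
  independence under the conditional measure of every stratum of positive probability.
  Independence factorizes \<open>E[R Y]\<close> as \<open>E[R] E[Y]\<close>, on the whole space for (a) and inside each
  stratum for (b).  If \<open>S\<close> is independent of the responses, all \<open>E[R d | S]\<close> are almost surely
  constant, so the weights \<open>\<lambda>\<close> equal 1 and the fixed-effects formula collapses to
  \<open>E[R 1 Y 1] / E[R 1] - E[R 0 Y 0] / E[R 0]\<close> by the tower property.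
\<close>

section \<open>Conditioning on an event of positive probability\<close>

context prob_space
begin

text \<open>\<open>uniform_measure\<close> divides by \<open>emeasure M A\<close> in the extended
  nonnegative reals. Positivity of \<open>prob A\<close> turns this quotient into
  \<open>ennreal\<close> of a real one, which is the shape that the integral rules for densities
  need.\<close>

lemma uniform_measure_eq_density:
  "prob A > 0 \<Longrightarrow> uniform_measure M A = density M (\<lambda>x. ennreal (indicator A x / prob A))"
  unfolding uniform_measure_def
  by (intro arg_cong[where f = "density M"])
    (auto simp: emeasure_eq_measure fun_eq_iff divide_ennreal split: split_indicator simp flip: ennreal_1)

lemma cond_exp_event_eq:
  assumes A: "A \<in> events" and pos: "prob A > 0" and f: "f \<in> borel_measurable M"
  shows "cond_exp_event M A f = (\<integral>x\<in>A. f x \<partial>M) / prob A"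
  unfolding cond_exp_event_def set_lebesgue_integral_def uniform_measure_eq_density[OF pos]
  using A f by (subst integral_density) auto

lemma prob_space_uniform_measure_pos:
  "prob A > 0 \<Longrightarrow> prob_space (uniform_measure M A)"
  by (intro prob_space_uniform_measure) (auto simp: emeasure_eq_measure)

text \<open>The density of the conditional measure is a constant multiple of the indicator of
  \<open>A\<close>, hence bounded, so it preserves integrability.\<close>

lemma integrable_uniform_measure:
  fixes f :: "'a \<Rightarrow> real"
  assumes A: "A \<in> events" and pos: "prob A > 0" and f: "integrable M f"
  shows "integrable (uniform_measure M A) f"
proof -
  have "integrable M (\<lambda>x. indicator A x / prob A * f x)"
    using integrable_mult_indicator[OF A f] by simp
  then show ?thesis
    using A f unfolding uniform_measure_eq_density[OF pos] by (subst integrable_density) auto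
qed

end

text \<open>Preimages form a pi-system, so a product rule checked on them extends to the generated
  sigma-algebras.\<close>

lemma Int_stable_vimage: "Int_stable {f -` B \<inter> \<Omega> |B. B \<in> sets N}"
proof (rule Int_stableI)
  fix a b assume "a \<in> {f -` B \<inter> \<Omega> |B. B \<in> sets N}" "b \<in> {f -` B \<inter> \<Omega> |B. B \<in> sets N}"
  then obtain B C where "a = f -` B \<inter> \<Omega>" "b = f -` C \<inter> \<Omega>" "B \<in> sets N" "C \<in> sets N"
    by blast
  then show "a \<inter> b \<in> {f -` B \<inter> \<Omega> |B. B \<in> sets N}"
    by (intro CollectI exI[of _ "B \<inter> C"]) auto
qed

section \<open>Conditional expectation given a random variable with finitely many values\<close>

locale finite_valued_rv = prob_space M for M :: "'a measure" +
  fixes T :: "'a \<Rightarrow> 's" and A :: "'s set"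
  assumes rv: "T \<in> measurable M (count_space A)"
    and finite_range: "finite A"
begin

abbreviation level :: "'s \<Rightarrow> 'a set" where
  "level s \<equiv> {\<omega> \<in> space M. T \<omega> = s}"

abbreviation gen :: "'a measure" where
  "gen \<equiv> vimage_algebra (space M) T (count_space UNIV)"

lemma T_in: "\<omega> \<in> space M \<Longrightarrow> T \<omega> \<in> A"
  using measurable_space[OF rv] by simp

lemma rv_UNIV: "T \<in> measurable M (count_space UNIV)"
  using measurable_compose[OF rv, of "\<lambda>s. s" "count_space UNIV"] by simp

lemma level_event [measurable, simp]: "level s \<in> events"
  using measurable_sets[OF rv_UNIV, of "{s}"] by (simp add: vimage_def Int_def conj_commute)

lemma subalgebra_gen: "finite_measure_subalgebra M gen"
proof
  show "subalgebra M gen"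
    unfolding subalgebra_def
    using measurable_sets[OF rv_UNIV] by (auto simp: sets_vimage_algebra2)
qed

sublocale gen: finite_measure_subalgebra M gen
  by (rule subalgebra_gen)

lemma measurable_gen_comp: "(\<lambda>\<omega>. g (T \<omega>)) \<in> measurable gen N" if "range g \<subseteq> space N"
  using that by (intro measurable_compose[OF measurable_vimage_algebra1]) auto

lemma borel_measurable_comp [measurable]: "(\<lambda>\<omega>. g (T \<omega>)) \<in> borel_measurable M"
  by (rule measurable_compose[OF rv_UNIV]) auto

text \<open>Each stratum of probability zero is a null event, and there are only finitely many
  strata.\<close>

lemma AE_level_pos: "AE \<omega> in M. prob (level (T \<omega>)) > 0"
proof -
  have "AE \<omega> in M. \<forall>s\<in>A. T \<omega> = s \<longrightarrow> prob (level s) > 0"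
  proof (rule AE_finite_allI[OF finite_range])
    fix s
    show "AE \<omega> in M. T \<omega> = s \<longrightarrow> prob (level s) > 0"
    proof (cases "prob (level s) > 0")
      case False
      then have "prob (level s) = 0" using measure_nonneg[of M "level s"] by linarith
      then have "AE \<omega> in M. \<omega> \<notin> level s" by (subst (asm) prob_eq_0) auto
      from this AE_space show ?thesis by eventually_elim auto
    qed simp
  qed
  with AE_space show ?thesis by eventually_elim (use T_in in auto)
qed

lemma AE_levelI: "AE \<omega> in M. P (T \<omega>)" if "\<And>s. prob (level s) > 0 \<Longrightarrow> P s"
  using AE_level_pos by eventually_elim (rule that)

text \<open>If \<open>P s\<close> failed, all of \<open>level s\<close> would lie in the exceptional
  null set, contradicting its positive probability. With \<open>AE_levelI\<close> this lets almost
  sure statements about \<open>T\<close> be exchanged for exact ones on the strata of positive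
  probability.\<close>

lemma AE_levelD:
  assumes "AE \<omega> in M. P (T \<omega>)" and pos: "prob (level s) > 0"
  shows "P s"
proof (rule ccontr)
  assume "\<not> P s"
  with assms(1) have "AE \<omega> in M. \<omega> \<notin> level s" by auto
  then have "prob (level s) = 0" by (subst prob_eq_0) auto
  with pos show False by simp
qed

lemma integrable_T: "integrable M (\<lambda>\<omega>. g (T \<omega>) :: real)"
proof (rule integrable_const_bound)
  \<comment> \<open>Any function of \<open>T\<close> takes finitely many values, so the sum of their
    absolute values is a bound.\<close>
  show "AE \<omega> in M. norm (g (T \<omega>)) \<le> (\<Sum>s\<in>A. \<bar>g s\<bar>)"
    using AE_space by eventually_elim (auto intro!: member_le_sum T_in finite_range)
qed simp

text \<open>The preimage of \<open>B\<close> is the disjoint union of the levels of the points of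
  \<open>A \<inter> B\<close>. At each outcome only the level of its own stratum contributes to the
  sum.\<close>

lemma set_integral_level_sum:
  fixes h :: "'a \<Rightarrow> real"
  assumes h: "integrable M h"
  shows "(\<integral>\<omega>\<in>T -` B \<inter> space M. h \<omega> \<partial>M) = (\<Sum>s\<in>A \<inter> B. \<integral>\<omega>\<in>level s. h \<omega> \<partial>M)"
proof -
  have "(\<integral>\<omega>\<in>T -` B \<inter> space M. h \<omega> \<partial>M)
      = (\<integral>\<omega>. (\<Sum>s\<in>A \<inter> B. indicator (level s) \<omega> * h \<omega>) \<partial>M)"
    unfolding set_lebesgue_integral_def
  proof (rule Bochner_Integration.integral_cong[OF refl])
    fix \<omega> assume \<omega>: "\<omega> \<in> space M"
    have "(\<Sum>s\<in>A \<inter> B. indicator (level s) \<omega> * h \<omega>) = (\<Sum>s\<in>A \<inter> B. if T \<omega> = s then h \<omega> else 0)"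
      using \<omega> by (intro sum.cong) (auto split: split_indicator)
    then show "indicator (T -` B \<inter> space M) \<omega> *\<^sub>R h \<omega>
        = (\<Sum>s\<in>A \<inter> B. indicator (level s) \<omega> * h \<omega>)"
      using \<omega> T_in[OF \<omega>] finite_range by (auto simp: sum.delta' split: split_indicator)
  qed
  also have "\<dots> = (\<Sum>s\<in>A \<inter> B. \<integral>\<omega>\<in>level s. h \<omega> \<partial>M)"
    unfolding set_lebesgue_integral_def
    using integrable_mult_indicator[OF level_event h]
    by (subst Bochner_Integration.integral_sum) auto
  finally show ?thesis .
qed

text \<open>The elementary conditional mean, evaluated at \<open>T\<close>, satisfies the two
  characterizing properties of conditional expectation: it is measurable for \<open>gen\<close>, and
  its integrals over the sets of \<open>gen\<close> agree with those of \<open>f\<close>. By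
  \<open>set_integral_level_sum\<close> the second needs checking on single levels only.\<close>

lemma cond_exp_rv_eq_at:
  assumes f: "integrable M f"
  shows "AE \<omega> in M. cond_exp_rv M T f \<omega> = cond_exp_at M T (T \<omega>) f"
proof -
  have int: "integrable M (\<lambda>\<omega>. cond_exp_at M T (T \<omega>) f)"
    by (rule integrable_T)
  show ?thesis
    unfolding cond_exp_rv_def
  proof (rule gen.real_cond_exp_charact[OF _ f int])
    show "(\<lambda>\<omega>. cond_exp_at M T (T \<omega>) f) \<in> borel_measurable gen"
      by (rule measurable_gen_comp) simp
  next
    fix C assume "C \<in> sets gen"
    then obtain B where C: "C = T -` B \<inter> space M" by (auto simp: sets_vimage_algebra2)
    have "(\<integral>\<omega>\<in>level s. f \<omega> \<partial>M) = (\<integral>\<omega>\<in>level s. cond_exp_at M T (T \<omega>) f \<partial>M)" for s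
    proof -
      have "(\<integral>\<omega>\<in>level s. cond_exp_at M T (T \<omega>) f \<partial>M) = (\<integral>\<omega>\<in>level s. cond_exp_at M T s f \<partial>M)"
        by (rule set_lebesgue_integral_cong) auto
      also have "\<dots> = prob (level s) * cond_exp_at M T s f"
        by (subst set_integral_const) (auto simp: emeasure_eq_measure)
      also have "\<dots> = (\<integral>\<omega>\<in>level s. f \<omega> \<partial>M)"
      \<comment> \<open>On a level of positive probability the mean is the integral divided by the
        probability, which cancels. On a null level the factor \<open>prob (level s)\<close> and the
        integral of \<open>f\<close> are both zero.\<close>
      proof (cases "prob (level s) > 0")
        case True
        then show ?thesis
          unfolding cond_exp_at_def using f by (subst cond_exp_event_eq) auto
      next
        case False
        then have "prob (level s) = 0" using measure_nonneg[of M "level s"] by linarith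
        moreover from this have "AE \<omega> in M. \<omega> \<notin> level s" by (subst (asm) prob_eq_0) auto
        then have "(\<integral>\<omega>\<in>level s. f \<omega> \<partial>M) = 0"
          unfolding set_lebesgue_integral_def
          by (intro integral_eq_zero_AE) (auto elim: eventually_mono split: split_indicator)
        ultimately show ?thesis by simp
      qed
      finally show ?thesis ..
    qed
    then show "(\<integral>\<omega>\<in>C. f \<omega> \<partial>M) = (\<integral>\<omega>\<in>C. cond_exp_at M T (T \<omega>) f \<partial>M)"
      unfolding C by (simp only: set_integral_level_sum[OF f] set_integral_level_sum[OF int])
  qed
qed

lemma cond_exp_rv_measurable [measurable]: "cond_exp_rv M T f \<in> borel_measurable M"
  unfolding cond_exp_rv_def by simp

lemma integral_cond_exp_rv: "integrable M f \<Longrightarrow> (\<integral>\<omega>. cond_exp_rv M T f \<omega> \<partial>M) = (\<integral>\<omega>. f \<omega> \<partial>M)"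
  unfolding cond_exp_rv_def by (rule gen.real_cond_exp_int)

lemma cond_exp_at_indicator:
  assumes E: "E \<in> events"
  shows "cond_exp_at M T s (indicator E) = measure (uniform_measure M (level s)) E"
  unfolding cond_exp_at_def cond_exp_event_def
  using E by simp

text \<open>Conditional expectations of indicators are, on each stratum, probabilities under its
  conditional measure. The defining identity of conditional independence therefore becomes the
  ordinary product rule there.\<close>

lemma cond_indep_var_level:
  assumes ind: "cond_indep_var M T N1 Z1 N2 Z2" and pos: "prob (level s) > 0"
  shows "prob_space.indep_var (uniform_measure M (level s)) N1 Z1 N2 Z2"
proof -
  define N where "N = uniform_measure M (level s)"
  interpret N: prob_space N
    unfolding N_def by (rule prob_space_uniform_measure_pos[OF pos])
  have [measurable]: "Z1 \<in> measurable M N1" "Z2 \<in> measurable M N2"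
    using ind unfolding cond_indep_var_def by auto
  have sp: "space N = space M" and sN: "sets N = events" unfolding N_def by auto
  have Z: "Z1 \<in> measurable N N1" "Z2 \<in> measurable N N2"
    by (auto simp: measurable_cong_sets[OF sN refl])
  have "N.indep_set {Z1 -` B \<inter> space N |B. B \<in> sets N1} {Z2 -` C \<inter> space N |C. C \<in> sets N2}"
  proof (rule N.indep_setI; safe?)
    fix B C assume B [measurable]: "B \<in> sets N1" and C [measurable]: "C \<in> sets N2"
    let ?I = "\<lambda>E. indicator E :: 'a \<Rightarrow> real"
    let ?BC = "{\<omega> \<in> space M. Z1 \<omega> \<in> B \<and> Z2 \<omega> \<in> C}"
    let ?B = "{\<omega> \<in> space M. Z1 \<omega> \<in> B}" and ?C = "{\<omega> \<in> space M. Z2 \<omega> \<in> C}"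
    have E: "?BC \<in> events" "?B \<in> events" "?C \<in> events" by measurable
    have i: "integrable M (?I E)" if "E \<in> events" for E
      using that by (simp add: emeasure_eq_measure)
    have "AE \<omega> in M. cond_exp_rv M T (?I ?BC) \<omega>
        = cond_exp_rv M T (?I ?B) \<omega> * cond_exp_rv M T (?I ?C) \<omega>"
      using ind B C unfolding cond_indep_var_def by blast
    with cond_exp_rv_eq_at[OF i[OF E(1)]] cond_exp_rv_eq_at[OF i[OF E(2)]]
      cond_exp_rv_eq_at[OF i[OF E(3)]]
    have "AE \<omega> in M. cond_exp_at M T (T \<omega>) (?I ?BC)
        = cond_exp_at M T (T \<omega>) (?I ?B) * cond_exp_at M T (T \<omega>) (?I ?C)"
      by eventually_elim simp
    \<comment> \<open>The exceptional null set may depend on \<open>B\<close> and \<open>C\<close>,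
      but it cannot contain the whole level, so the identity holds exactly at \<open>s\<close> for
      every pair.\<close>
    from AE_levelD[OF this pos] have "N.prob ?BC = N.prob ?B * N.prob ?C"
      using E by (simp only: cond_exp_at_indicator N_def)
    moreover have "?BC = Z1 -` B \<inter> space N \<inter> (Z2 -` C \<inter> space N)"
      "?B = Z1 -` B \<inter> space N" "?C = Z2 -` C \<inter> space N"
      by (auto simp: sp)
    ultimately show "N.prob (Z1 -` B \<inter> space N \<inter> (Z2 -` C \<inter> space N))
        = N.prob (Z1 -` B \<inter> space N) * N.prob (Z2 -` C \<inter> space N)"
      by simp
  qed (use Z measurable_sets in blast)+
  \<comment> \<open>Passage from the two pi-systems of preimages to the sigma-algebras that they
    generate.\<close>
  then have "N.indep_set (sigma_sets (space N) {Z1 -` B \<inter> space N |B. B \<in> sets N1})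
       (sigma_sets (space N) {Z2 -` C \<inter> space N |C. C \<in> sets N2})"
    by (rule N.indep_set_sigma_sets) (rule Int_stable_vimage)+
  with Z show ?thesis unfolding N_def[symmetric] N.indep_var_eq by blast
qed

end

section \<open>Factorization of product moments, on any probability space\<close>

lemma (in prob_space) indep_var_integral_mult_pairs:
  fixes Y R :: "nat \<Rightarrow> 'a \<Rightarrow> real"
  assumes ind: "indep_var borel (\<lambda>\<omega>. (Y 1 \<omega>, Y 0 \<omega>)) borel (\<lambda>\<omega>. (R 1 \<omega>, R 0 \<omega>))"
    and d: "d \<in> {0, 1}" and Y: "integrable M (Y d)" and R: "integrable M (R d)"
  shows "(\<integral>\<omega>. R d \<omega> * Y d \<omega> \<partial>M) = (\<integral>\<omega>. R d \<omega> \<partial>M) * (\<integral>\<omega>. Y d \<omega> \<partial>M)"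
proof -
  \<comment> \<open>The hypothesis concerns pairs. The coordinate belonging to \<open>d\<close> (the
    first for treatment 1, the second for treatment 0) is a Borel map, so composing with it gives
    independence of \<open>Y d\<close> and \<open>R d\<close>, to which the product formula for
    expectations applies.\<close>
  define \<pi> :: "real \<times> real \<Rightarrow> real" where "\<pi> = (if d = 1 then fst else snd)"
  have [measurable]: "\<pi> \<in> borel_measurable borel"
    by (auto simp: \<pi>_def borel_prod[symmetric])
  have "indep_var borel (\<pi> \<circ> (\<lambda>\<omega>. (Y 1 \<omega>, Y 0 \<omega>))) borel (\<pi> \<circ> (\<lambda>\<omega>. (R 1 \<omega>, R 0 \<omega>)))"
    by (rule indep_var_compose[OF ind]) auto
  moreover have "\<pi> \<circ> (\<lambda>\<omega>. (Z 1 \<omega>, Z 0 \<omega>)) = Z d" for Z :: "nat \<Rightarrow> 'a \<Rightarrow> real"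
    using d by (auto simp: \<pi>_def)
  ultimately have "indep_var borel (Y d) borel (R d)" by simp
  from indep_var_lebesgue_integral[OF this Y R] show ?thesis
    by (simp add: mult.commute)
qed

section \<open>The attrition model and the contrast among responders\<close>

locale stratified_attrition = finite_valued_rv M T A
  for M :: "'a measure" and T :: "'a \<Rightarrow> 's" and A +
  fixes Y R :: "nat \<Rightarrow> 'a \<Rightarrow> real" and \<nu> :: real
  assumes Y_int: "d \<in> {0, 1} \<Longrightarrow> integrable M (Y d)"
    and R_meas: "d \<in> {0, 1} \<Longrightarrow> R d \<in> borel_measurable M"
    and R_range: "d \<in> {0, 1} \<Longrightarrow> \<omega> \<in> space M \<Longrightarrow> R d \<omega> \<in> {0, 1}"
    and R_pos: "d \<in> {0, 1} \<Longrightarrow> (\<integral>\<omega>. R d \<omega> \<partial>M) > 0"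
    and nu: "0 < \<nu>" "\<nu> < 1"
begin

abbreviation outcome_indep :: "'a measure \<Rightarrow> bool" where
  "outcome_indep N \<equiv>
     prob_space.indep_var N borel (\<lambda>\<omega>. (Y 1 \<omega>, Y 0 \<omega>)) borel (\<lambda>\<omega>. (R 1 \<omega>, R 0 \<omega>))"

abbreviation outcome_cond_indep :: bool where
  "outcome_cond_indep \<equiv>
     cond_indep_var M T borel (\<lambda>\<omega>. (Y 1 \<omega>, Y 0 \<omega>)) borel (\<lambda>\<omega>. (R 1 \<omega>, R 0 \<omega>))"

abbreviation stratum_indep :: bool where
  "stratum_indep \<equiv> indep_rv M (count_space A) T borel (\<lambda>\<omega>. (R 1 \<omega>, R 0 \<omega>))"

lemma R_int: "d \<in> {0, 1} \<Longrightarrow> integrable M (R d)"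
  using R_range R_meas by (intro integrable_const_bound[where B = 1] AE_I2) fastforce+

lemma RY_int: "integrable M (\<lambda>\<omega>. R d \<omega> * Y d \<omega>)" if d: "d \<in> {0, 1}"
proof (rule Bochner_Integration.integrable_bound[OF Y_int[OF d]])
  show "AE \<omega> in M. norm (R d \<omega> * Y d \<omega>) \<le> norm (Y d \<omega>)"
    using R_range[OF d] by (intro AE_I2) fastforce
qed (use R_meas[OF d] Y_int[OF d] in measurable)

lemma responders_event [measurable, simp]:
  "d \<in> {0, 1} \<Longrightarrow> {\<omega> \<in> space M. R d \<omega> = 1} \<in> events"
  using R_meas[of d] by measurable

text \<open>Replacing the response by an indicator turns integrals over the responders into moments
  of \<open>R d\<close> and \<open>R d * Y d\<close>.\<close>

lemma R_eq_indicator: "d \<in> {0, 1} \<Longrightarrow> \<omega> \<in> space M \<Longrightarrow> R d \<omega> = indicator {\<omega> \<in> space M. R d \<omega> = 1} \<omega>"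
  using R_range[of d \<omega>] by (auto split: split_indicator)

lemma prob_responders:
  assumes d: "d \<in> {0, 1}"
  shows "prob {\<omega> \<in> space M. R d \<omega> = 1} = (\<integral>\<omega>. R d \<omega> \<partial>M)"
proof -
  have "(\<integral>\<omega>. R d \<omega> \<partial>M) = (\<integral>\<omega>. indicator {\<omega> \<in> space M. R d \<omega> = 1} \<omega> \<partial>M)"
    by (rule Bochner_Integration.integral_cong[OF refl]) (rule R_eq_indicator[OF d])
  also have "\<dots> = prob ({\<omega> \<in> space M. R d \<omega> = 1} \<inter> space M)"
    by (rule Bochner_Integration.integral_indicator)
  also have "{\<omega> \<in> space M. R d \<omega> = 1} \<inter> space M = {\<omega> \<in> space M. R d \<omega> = 1}"
    by blast
  finally show ?thesis ..
qed

lemma cond_exp_responders: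
  assumes d: "d \<in> {0, 1}"
  shows "cond_exp_event M {\<omega> \<in> space M. R d \<omega> = 1} (Y d)
    = (\<integral>\<omega>. R d \<omega> * Y d \<omega> \<partial>M) / (\<integral>\<omega>. R d \<omega> \<partial>M)"
proof -
  have "(\<integral>\<omega>\<in>{\<omega> \<in> space M. R d \<omega> = 1}. Y d \<omega> \<partial>M) = (\<integral>\<omega>. R d \<omega> * Y d \<omega> \<partial>M)"
    unfolding set_lebesgue_integral_def
    by (rule Bochner_Integration.integral_cong[OF refl]) (simp add: R_eq_indicator[OF d, symmetric])
  then show ?thesis
    using d R_pos[OF d] Y_int[OF d] by (subst cond_exp_event_eq) (auto simp: prob_responders)
qed

text \<open>The ratio form of the observed contrast, from which both (a) and (c) are
  derived.\<close>

lemma theta_obs_eq: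
  "theta_obs M Y R = (\<integral>\<omega>. R 1 \<omega> * Y 1 \<omega> \<partial>M) / (\<integral>\<omega>. R 1 \<omega> \<partial>M)
     - (\<integral>\<omega>. R 0 \<omega> * Y 0 \<omega> \<partial>M) / (\<integral>\<omega>. R 0 \<omega> \<partial>M)"
  unfolding theta_obs_def by (simp add: cond_exp_responders)

lemma theta_obs_eq_ate: "theta_obs M Y R = ate M Y" if "outcome_indep M"
  unfolding theta_obs_eq ate_def
  using R_pos[of 0] R_pos[of 1]
  by (simp add: indep_var_integral_mult_pairs[OF that] Y_int R_int)

section \<open>The fixed-effects estimand under independence within strata\<close>

lemma theta_sfe_eq_weighted:
  assumes ind: outcome_cond_indep
  shows "theta_sfe M \<nu> T Y R
    = (\<integral>\<omega>. stratum_ate M T Y (T \<omega>) * stratum_weight M \<nu> T R (T \<omega>) \<partial>M)"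
proof -
  let ?at = "cond_exp_at M T"
  let ?D = "\<lambda>s. \<nu> * ?at s (R 1) + (1 - \<nu>) * ?at s (R 0)"
  \<comment> \<open>Within a stratum of positive probability, outcomes and responses are independent
    under the conditional measure, so the moment of \<open>R d * Y d\<close> factorizes;
    integrability carries over from \<open>M\<close>, so the mean of the difference splits as
    well.\<close>
  have level: "?at s (\<lambda>\<omega>. R d \<omega> * Y d \<omega>) = ?at s (R d) * ?at s (Y d)"
      "stratum_ate M T Y s = ?at s (Y 1) - ?at s (Y 0)"
    if pos: "prob (level s) > 0" and d: "d \<in> {0, 1}" for s d
  proof -
    interpret N: prob_space "uniform_measure M (level s)"
      by (rule prob_space_uniform_measure_pos[OF pos])
    have i: "integrable (uniform_measure M (level s)) f" if "integrable M f" for f :: "'a \<Rightarrow> real"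
      by (rule integrable_uniform_measure[OF _ pos that]) simp
    show "?at s (\<lambda>\<omega>. R d \<omega> * Y d \<omega>) = ?at s (R d) * ?at s (Y d)"
      unfolding cond_exp_at_def cond_exp_event_def
      by (rule N.indep_var_integral_mult_pairs[OF cond_indep_var_level[OF ind pos] d])
        (intro i Y_int R_int d)+
    show "stratum_ate M T Y s = ?at s (Y 1) - ?at s (Y 0)"
      unfolding stratum_ate_def cond_exp_at_def cond_exp_event_def
      by (rule Bochner_Integration.integral_diff) (intro i Y_int; simp)+
  qed
  have "AE \<omega> in M. ?at (T \<omega>) (\<lambda>\<omega>. R 1 \<omega> * Y 1 \<omega>) = ?at (T \<omega>) (R 1) * ?at (T \<omega>) (Y 1)
      \<and> ?at (T \<omega>) (\<lambda>\<omega>. R 0 \<omega> * Y 0 \<omega>) = ?at (T \<omega>) (R 0) * ?at (T \<omega>) (Y 0)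
      \<and> stratum_ate M T Y (T \<omega>) = ?at (T \<omega>) (Y 1) - ?at (T \<omega>) (Y 0)"
    by (rule AE_levelI) (use level in auto)
  moreover have "AE \<omega> in M. cond_exp_rv M T f \<omega> = ?at (T \<omega>) f"
    if "f \<in> {\<lambda>\<omega>. R 1 \<omega> * Y 1 \<omega>, \<lambda>\<omega>. R 0 \<omega> * Y 0 \<omega>, R 1, R 0}" for f
    using that RY_int R_int by (intro cond_exp_rv_eq_at) auto
  note this[of "\<lambda>\<omega>. R 1 \<omega> * Y 1 \<omega>", simplified] this[of "\<lambda>\<omega>. R 0 \<omega> * Y 0 \<omega>", simplified]
    this[of "R 1", simplified] this[of "R 0", simplified]
  ultimately have "AE \<omega> in M. inverse (mean_weight M \<nu> T R) *
      ((cond_exp_rv M T (\<lambda>\<omega>. R 1 \<omega> * Y 1 \<omega>) \<omega> * cond_exp_rv M T (R 0) \<omega> -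
           cond_exp_rv M T (\<lambda>\<omega>. R 0 \<omega> * Y 0 \<omega>) \<omega> * cond_exp_rv M T (R 1) \<omega>) /
          (\<nu> * cond_exp_rv M T (R 1) \<omega> + (1 - \<nu>) * cond_exp_rv M T (R 0) \<omega>))
      = stratum_ate M T Y (T \<omega>) * stratum_weight M \<nu> T R (T \<omega>)"
  proof eventually_elim
    case (elim \<omega>)
    then show ?case
      \<comment> \<open>After factorization the numerator is the product of both response rates
        times the stratum effect. Both sides have the same denominator, so the identity survives the
        convention that division by zero is zero.\<close>
      by (simp add: stratum_weight_def) (simp add: algebra_simps diff_divide_distrib)
  qed
  then show ?thesis
    \<comment> \<open>Moving the constant factor under the integral requires no integrability of the
      integrand.\<close>
    unfolding theta_sfe_def by (subst integral_mult_right_zero[symmetric]) (rule integral_cong_AE, auto)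
qed

section \<open>Strata independent of the responses\<close>

lemma cond_exp_at_R:
  assumes ind: stratum_indep and d: "d \<in> {0, 1}" and pos: "prob (level s) > 0"
  shows "cond_exp_at M T s (R d) = (\<integral>\<omega>. R d \<omega> \<partial>M)"
proof -
  let ?E = "{\<omega> \<in> space M. R d \<omega> = 1}"
  \<comment> \<open>\<open>C\<close> collects the response pairs whose coordinate for
    \<open>d\<close> is 1, which makes \<open>?E\<close> a preimage under the pair of
    responses.\<close>
  define C :: "(real \<times> real) set" where "C = (if d = 1 then {1} \<times> UNIV else UNIV \<times> {1})"
  have C: "C \<in> sets borel"
    by (auto simp: C_def borel_prod[symmetric])
  \<comment> \<open>Independence of the strata is stated over \<open>count_space A\<close>, so
    \<open>{s}\<close> is an admissible set only once \<open>s\<close> is known to lie in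
    \<open>A\<close>.\<close>
  have "level s \<noteq> {}"
    using pos by (metis measure_empty less_irrefl)
  then have "s \<in> A"
    using T_in by auto
  then have 1: "level s \<in> {T -` B \<inter> space M |B. B \<in> sets (count_space A)}"
    by (intro CollectI exI[of _ "{s}"]) auto
  have 2: "?E \<in> {(\<lambda>\<omega>. (R 1 \<omega>, R 0 \<omega>)) -` B \<inter> space M |B. B \<in> sets borel}"
    using d C by (intro CollectI exI[of _ C]) (auto simp: C_def)
  \<comment> \<open>The conditional mean of \<open>R d\<close> is the probability of this
    intersection divided by \<open>prob (level s)\<close>; the product rule cancels the
    latter.\<close>
  have "prob (level s \<inter> ?E) = prob (level s) * prob ?E"
    using ind unfolding indep_rv_def
    by (intro indep_setD[OF _ sigma_sets.Basic[OF 1] sigma_sets.Basic[OF 2]]) blast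
  moreover have "(\<integral>\<omega>\<in>level s. R d \<omega> \<partial>M) = prob (level s \<inter> ?E)"
  proof -
    have "(\<integral>\<omega>\<in>level s. R d \<omega> \<partial>M) = (\<integral>\<omega>. indicator (level s \<inter> ?E) \<omega> \<partial>M)"
      unfolding set_lebesgue_integral_def
      by (rule Bochner_Integration.integral_cong[OF refl])
        (use R_range[OF d] in \<open>auto split: split_indicator\<close>)
    also have "\<dots> = prob (level s \<inter> ?E \<inter> space M)"
      by (rule Bochner_Integration.integral_indicator)
    also have "level s \<inter> ?E \<inter> space M = level s \<inter> ?E"
      by blast
    finally show ?thesis .
  qed
  ultimately show ?thesis
    unfolding cond_exp_at_def
    using d pos R_meas[OF d]
    by (subst cond_exp_event_eq[OF level_event pos R_meas[OF d]]) (simp add: prob_responders)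
qed

text \<open>With constant response rates every stratum has the same denominator \<open>D\<close>, a
  convex combination of two positive numbers. The integrand of \<open>mean_weight\<close> is then
  almost surely constant.\<close>

lemma stratum_indep_constants:
  assumes ind: stratum_indep
  defines "D \<equiv> \<nu> * (\<integral>\<omega>. R 1 \<omega> \<partial>M) + (1 - \<nu>) * (\<integral>\<omega>. R 0 \<omega> \<partial>M)"
  shows "D > 0"
    and "d \<in> {0, 1} \<Longrightarrow> AE \<omega> in M. cond_exp_rv M T (R d) \<omega> = (\<integral>\<omega>. R d \<omega> \<partial>M)"
    and "mean_weight M \<nu> T R = (\<integral>\<omega>. R 1 \<omega> \<partial>M) * (\<integral>\<omega>. R 0 \<omega> \<partial>M) / D"
proof -
  show "D > 0" unfolding D_def using nu R_pos[of 0] R_pos[of 1] by (intro add_pos_pos) auto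
  show R: "AE \<omega> in M. cond_exp_rv M T (R d) \<omega> = (\<integral>\<omega>. R d \<omega> \<partial>M)" if d: "d \<in> {0, 1}" for d
  proof -
    have "AE \<omega> in M. cond_exp_at M T (T \<omega>) (R d) = (\<integral>\<omega>. R d \<omega> \<partial>M)"
      by (rule AE_levelI) (rule cond_exp_at_R[OF ind d])
    with cond_exp_rv_eq_at[OF R_int[OF d]] show ?thesis by eventually_elim simp
  qed
  have "mean_weight M \<nu> T R = (\<integral>\<omega>. (\<integral>\<omega>. R 1 \<omega> \<partial>M) * (\<integral>\<omega>. R 0 \<omega> \<partial>M) / D \<partial>M)"
    unfolding mean_weight_def
  proof (rule integral_cong_AE)
    show "AE \<omega> in M. cond_exp_rv M T (R 1) \<omega> * cond_exp_rv M T (R 0) \<omega> /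
        (\<nu> * cond_exp_rv M T (R 1) \<omega> + (1 - \<nu>) * cond_exp_rv M T (R 0) \<omega>)
        = (\<integral>\<omega>. R 1 \<omega> \<partial>M) * (\<integral>\<omega>. R 0 \<omega> \<partial>M) / D"
      using R[of 0, simplified] R[of 1, simplified] by eventually_elim (simp add: D_def)
  qed auto
  then show "mean_weight M \<nu> T R = (\<integral>\<omega>. R 1 \<omega> \<partial>M) * (\<integral>\<omega>. R 0 \<omega> \<partial>M) / D"
    by (simp add: prob_space)
qed

lemma theta_sfe_eq_obs:
  assumes ind: stratum_indep
  shows "theta_sfe M \<nu> T Y R = theta_obs M Y R"
proof -
  let ?r = "\<lambda>d. \<integral>\<omega>. R d \<omega> \<partial>M" and ?RY = "\<lambda>d \<omega>. R d \<omega> * Y d \<omega>"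
  define D where "D = \<nu> * ?r 1 + (1 - \<nu>) * ?r 0"
  note const = stratum_indep_constants[OF ind, folded D_def]
  \<comment> \<open>Integrability of the conditional expectations allows the integral of their
    linear combination to be split, after which the tower property removes the conditioning.\<close>
  have i: "integrable M (cond_exp_rv M T (?RY d))" if "d \<in> {0, 1}" for d
    unfolding cond_exp_rv_def by (rule gen.real_cond_exp_int[OF RY_int[OF that]])
  have "(\<integral>\<omega>. (cond_exp_rv M T (?RY 1) \<omega> * cond_exp_rv M T (R 0) \<omega> -
        cond_exp_rv M T (?RY 0) \<omega> * cond_exp_rv M T (R 1) \<omega>) /
        (\<nu> * cond_exp_rv M T (R 1) \<omega> + (1 - \<nu>) * cond_exp_rv M T (R 0) \<omega>) \<partial>M)
      = (\<integral>\<omega>. (cond_exp_rv M T (?RY 1) \<omega> * ?r 0 - cond_exp_rv M T (?RY 0) \<omega> * ?r 1) / D \<partial>M)"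
  proof (rule integral_cong_AE)
    show "AE \<omega> in M. (cond_exp_rv M T (?RY 1) \<omega> * cond_exp_rv M T (R 0) \<omega> -
        cond_exp_rv M T (?RY 0) \<omega> * cond_exp_rv M T (R 1) \<omega>) /
        (\<nu> * cond_exp_rv M T (R 1) \<omega> + (1 - \<nu>) * cond_exp_rv M T (R 0) \<omega>)
        = (cond_exp_rv M T (?RY 1) \<omega> * ?r 0 - cond_exp_rv M T (?RY 0) \<omega> * ?r 1) / D"
      using const(2)[of 0, simplified] const(2)[of 1, simplified]
      by eventually_elim (simp add: D_def)
  qed auto
  also have "\<dots> = ((\<integral>\<omega>. ?RY 1 \<omega> \<partial>M) * ?r 0 - (\<integral>\<omega>. ?RY 0 \<omega> \<partial>M) * ?r 1) / D"
    using i[of 0] i[of 1] RY_int[of 0] RY_int[of 1] by (simp add: integral_cond_exp_rv)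
  \<comment> \<open>Here \<open>mean_weight\<close> is \<open>?r 1 * ?r 0 / D\<close>. Dividing by
    it cancels \<open>D\<close> and leaves each moment divided by its own response rate.\<close>
  finally show ?thesis
    unfolding theta_sfe_def theta_obs_eq const(3)
    using const(1) R_pos[of 0] R_pos[of 1] by (simp add: field_simps)
qed

text \<open>In every stratum of positive probability the unnormalized weight coincides with
  \<open>mean_weight\<close>, so the normalized weight is 1. What remains is the mean of the stratum
  effects, which the tower property identifies with \<open>ate\<close>.\<close>

lemma weighted_stratum_ate_eq_ate:
  assumes ind: stratum_indep
  shows "(\<integral>\<omega>. stratum_ate M T Y (T \<omega>) * stratum_weight M \<nu> T R (T \<omega>) \<partial>M) = ate M Y"
proof -
  have Y: "integrable M (\<lambda>\<omega>. Y 1 \<omega> - Y 0 \<omega>)"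
    using Y_int by auto
  note const = stratum_indep_constants[OF ind]
  have "AE \<omega> in M. stratum_weight M \<nu> T R (T \<omega>) = 1"
  proof (rule AE_levelI)
    fix s assume "prob (level s) > 0"
    then show "stratum_weight M \<nu> T R s = 1"
      using const(1) R_pos[of 0] R_pos[of 1]
      by (simp add: stratum_weight_def const(3) cond_exp_at_R[OF ind])
  qed
  with cond_exp_rv_eq_at[OF Y]
  have "AE \<omega> in M. stratum_ate M T Y (T \<omega>) * stratum_weight M \<nu> T R (T \<omega>)
      = cond_exp_rv M T (\<lambda>\<omega>. Y 1 \<omega> - Y 0 \<omega>) \<omega>"
    by eventually_elim (simp add: stratum_ate_def)
  then have "(\<integral>\<omega>. stratum_ate M T Y (T \<omega>) * stratum_weight M \<nu> T R (T \<omega>) \<partial>M)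
      = (\<integral>\<omega>. cond_exp_rv M T (\<lambda>\<omega>. Y 1 \<omega> - Y 0 \<omega>) \<omega> \<partial>M)"
    by (intro integral_cong_AE) auto
  then show ?thesis
    unfolding ate_def by (simp only: integral_cond_exp_rv[OF Y])
qed

end

section \<open>The four claims for strata generated by covariates\<close>

theorem corollary3p2:
  fixes M :: "'a measure"
    and Y R :: "nat \<Rightarrow> 'a \<Rightarrow> real"
    and MX :: "'x measure"
    and X :: "'a \<Rightarrow> 'x"
    and S :: "'x \<Rightarrow> 's"
    and strata :: "'s set"
    and \<nu> :: real
  assumes "prob_space M"
    and Y_int: "\<And>d. d \<in> {0, 1} \<Longrightarrow> integrable M (Y d)"
    and R_meas: "\<And>d. d \<in> {0, 1} \<Longrightarrow> R d \<in> borel_measurable M"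
    and R_range: "\<And>d \<omega>. d \<in> {0, 1} \<Longrightarrow> \<omega> \<in> space M \<Longrightarrow> R d \<omega> \<in> {0, 1}"
    and R_pos: "\<And>d. d \<in> {0, 1} \<Longrightarrow> (\<integral>\<omega>. R d \<omega> \<partial>M) > 0"
    and X_meas: "X \<in> measurable M MX"
    and S_meas: "S \<in> measurable MX (count_space strata)"
    and "finite strata"
    and "0 < \<nu>" "\<nu> < 1"
  shows
    "(prob_space.indep_var M borel (\<lambda>\<omega>. (Y 1 \<omega>, Y 0 \<omega>)) borel (\<lambda>\<omega>. (R 1 \<omega>, R 0 \<omega>)) \<longrightarrow>
        theta_obs M Y R = ate M Y) \<and>
     (cond_indep_var M (S \<circ> X) borel (\<lambda>\<omega>. (Y 1 \<omega>, Y 0 \<omega>)) borel (\<lambda>\<omega>. (R 1 \<omega>, R 0 \<omega>)) \<longrightarrow>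
        theta_sfe M \<nu> (S \<circ> X) Y R =
        (\<integral>\<omega>. stratum_ate M (S \<circ> X) Y ((S \<circ> X) \<omega>) * stratum_weight M \<nu> (S \<circ> X) R ((S \<circ> X) \<omega>) \<partial>M)) \<and>
     (indep_rv M (count_space strata) (S \<circ> X) borel (\<lambda>\<omega>. (R 1 \<omega>, R 0 \<omega>)) \<longrightarrow>
        theta_sfe M \<nu> (S \<circ> X) Y R = theta_obs M Y R) \<and>
     (indep_rv M (count_space strata) (S \<circ> X) borel (\<lambda>\<omega>. (R 1 \<omega>, R 0 \<omega>)) \<and>
      (prob_space.indep_var M borel (\<lambda>\<omega>. (Y 1 \<omega>, Y 0 \<omega>)) borel (\<lambda>\<omega>. (R 1 \<omega>, R 0 \<omega>)) \<or>
       cond_indep_var M (S \<circ> X) borel (\<lambda>\<omega>. (Y 1 \<omega>, Y 0 \<omega>)) borel (\<lambda>\<omega>. (R 1 \<omega>, R 0 \<omega>))) \<longrightarrow>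
        theta_sfe M \<nu> (S \<circ> X) Y R = ate M Y)"
  proof -
  interpret prob_space M by fact
  interpret stratified_attrition M "S \<circ> X" strata Y R \<nu>
    using assms by unfold_locales (auto intro: measurable_comp)
  let ?T = "S \<circ> X"
  show ?thesis
  proof (intro conjI impI)
    show "theta_obs M Y R = ate M Y" if "outcome_indep M"
      by (rule theta_obs_eq_ate[OF that])
    show "theta_sfe M \<nu> ?T Y R
        = (\<integral>\<omega>. stratum_ate M ?T Y (?T \<omega>) * stratum_weight M \<nu> ?T R (?T \<omega>) \<partial>M)"
      if outcome_cond_indep
      by (rule theta_sfe_eq_weighted[OF that])
    show "theta_sfe M \<nu> ?T Y R = theta_obs M Y R" if stratum_indep
      by (rule theta_sfe_eq_obs[OF that])
    \<comment> \<open>Unconditional independence goes through \<open>theta_obs\<close>, by (c) and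
      then (a). Otherwise conditional independence holds, and (b) applies with unit weights.\<close>
    show "theta_sfe M \<nu> ?T Y R = ate M Y"
      if H: "stratum_indep \<and> (outcome_indep M \<or> outcome_cond_indep)"
    proof (cases "outcome_indep M")
      case True
      then show ?thesis
        using H by (simp only: theta_sfe_eq_obs theta_obs_eq_ate)
    next
      case False
      then have outcome_cond_indep and stratum_indep using H by blast+
      then show ?thesis
        by (simp only: theta_sfe_eq_weighted weighted_stratum_ate_eq_ate)
    qed
  qed
qed

end
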